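(* For $|q|<1$, $$\sum_{n\ge 0}\sum_{r\ge 0}\frac{a^{n+r}q^{n^2+2r^2}}{(aq;q^2)_n(q^2;q^2)_r(q;q)_{n-2r}}=\frac{1}{(aq;q)_\infty}\sum_{r\ge 0}\frac{(-1)^ra^{4r}q^{9r^2-r}(1-aq^{4r})(a;q^2)_r}{(1-a)(q^2;q^2)_r}.$$
   Context: $(x;q)_m=\prod_{j=0}^{m-1}(1-xq^j)$ and $(x;q)_\infty=\prod_{j=0}^\infty(1-xq^j)$. By convention $1/(q;q)_m=0$ for $m<0$, so only terms with $n\ge 2r$ contribute. Here $a$ is a parameter for which no denominators vanish (equivalently, the identity holds as power series in $a$ and $q$). *)

theory Defs
  imports "HOL-Analysis.Analysis"
begin

definition qpoch :: "complex \<Rightarrow> complex \<Rightarrow> nat \<Rightarrow> complex" where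
  "qpoch x q m = (\<Prod>j<m. 1 - x * q ^ j)"

definition qpoch_inf :: "complex \<Rightarrow> complex \<Rightarrow> complex" where
  "qpoch_inf x q = (\<Prod>j. 1 - x * q ^ j)"

(* 1 / (q;q)_m for an integer index m, with the convention that it is 0 for m < 0 *)
definition recip_qpoch :: "complex \<Rightarrow> int \<Rightarrow> complex" where
  "recip_qpoch q m = (if m < 0 then 0 else 1 / qpoch q q (nat m))"

definition lhs_term :: "complex \<Rightarrow> complex \<Rightarrow> nat \<Rightarrow> nat \<Rightarrow> complex" where
  "lhs_term a q n r =
     a ^ (n + r) * q ^ (n\<^sup>2 + 2 * r\<^sup>2) / (qpoch (a * q) (q\<^sup>2) n * qpoch (q\<^sup>2) (q\<^sup>2) r)
       * recip_qpoch q (int n - 2 * int r)"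

(* The natural-number subtraction in the exponent never truncates: r <= 9 r^2. *)
definition rhs_term :: "complex \<Rightarrow> complex \<Rightarrow> nat \<Rightarrow> complex" where
  "rhs_term a q r =
     (- 1) ^ r * a ^ (4 * r) * q ^ (9 * r\<^sup>2 - r) * (1 - a * q ^ (4 * r)) * qpoch a (q\<^sup>2) r
       / ((1 - a) * qpoch (q\<^sup>2) (q\<^sup>2) r)"

end

theory Submission
  imports Defs
begin

text \<open>
  The identity is an instance of the Bailey pair method. Sequences \<open>\<alpha>\<close> and \<open>\<beta>\<close> form a Bailey pair
  relative to \<open>a\<close> in base \<open>p\<close> when \<open>\<beta> n = (\<Sum>r\<le>n. \<alpha> r / ((p;p)\<^bsub>n-r\<^esub> (ap;p)\<^bsub>n+r\<^esub>))\<close>. Pairing such sequences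
  with \<open>a\<^sup>n p\<^bsup>n\<^sup>2\<^esup>\<close> turns a sum over \<open>\<beta>\<close> into a sum over \<open>\<alpha>\<close>, because
  \<open>\<Sum>n. a\<^sup>n p\<^bsup>n\<^sup>2\<^esup> / ((p;p)\<^bsub>n-r\<^esub> (ap;p)\<^bsub>n+r\<^esub>) = a\<^sup>r p\<^bsup>r\<^sup>2\<^esup> / (ap;p)\<^sub>\<infinity>\<close>.

  The pair needed here is built in three steps. The unit pair has \<open>\<beta> n = [n = 0]\<close>; one step of the
  Bailey lemma multiplies its \<open>\<alpha> r\<close> by \<open>a\<^sup>r p\<^bsup>r\<^sup>2\<^esup>\<close> and replaces \<open>\<beta> n\<close> by \<open>1 / (p;p)\<^sub>n\<close>
  (\<open>unit_pair_step\<close>). This is used in base \<open>p = q\<^sup>2\<close>. A change of base from \<open>q\<^sup>2\<close> to \<open>q\<close>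
  (\<open>base_change_kernel\<close>) then yields a pair in base \<open>q\<close> whose \<open>\<alpha>\<close> is supported on even indices and
  whose \<open>\<beta> n\<close>, multiplied by \<open>a\<^sup>n q\<^bsup>n\<^sup>2\<^esup>\<close>, is exactly the inner sum over \<open>r\<close> on the left-hand side
  (\<open>inner_sum_expansion\<close>). The change of base is a terminating quadratic form of the \<open>q\<close>-Gauss sum
  (\<open>q_gauss_quadratic\<close>).

  It remains to sum over \<open>n\<close> first. The double series converges absolutely, being dominated by a product
  of two series of the form \<open>\<Sum>n. x\<^sup>n y\<^bsup>n\<^sup>2\<^esup>\<close> with \<open>y < 1\<close>, so the order can be exchanged, and Cauchy's
  identity (\<open>shifted_cauchy_identity\<close>) evaluates the sum over \<open>n\<close>. The result is the right-hand side.
\<close>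

section \<open>Finite \<open>q\<close>-products and \<open>q\<close>-binomial coefficients\<close>

lemma qpoch_0 [simp]: "qpoch x q 0 = 1"
  by (simp add: qpoch_def)

lemma qpoch_Suc: "qpoch x q (Suc n) = qpoch x q n * (1 - x * q ^ n)"
  by (simp add: qpoch_def)

lemma qpoch_add: "qpoch x q (m + n) = qpoch x q m * qpoch (x * q ^ m) q n"
  by (induction n) (simp_all add: qpoch_Suc power_add mult_ac)

lemma qpoch_Suc_left: "qpoch x q (Suc n) = (1 - x) * qpoch (x * q) q n"
  using qpoch_add[of x q 1 n] by (simp add: qpoch_Suc)

lemma qpoch_double: "qpoch x q (2 * n) = qpoch x (q\<^sup>2) n * qpoch (x * q) (q\<^sup>2) n"
  by (induction n) (simp_all add: qpoch_Suc power_mult [symmetric] mult_ac)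

lemma qpoch_q_q_nonzero:
  assumes "norm q < 1"
  shows "qpoch q q n \<noteq> 0"
proof -
  have "q * q ^ j \<noteq> 1" for j
  proof
    assume "q * q ^ j = 1"
    then have "norm q ^ Suc j = 1"
      by (metis norm_one norm_power power_Suc)
    moreover have "norm q ^ Suc j < 1"
      using assms power_less_one_iff[of "norm q" "Suc j"] by (simp del: power_Suc)
    ultimately show False by simp
  qed
  then show ?thesis
    by (simp add: qpoch_def)
qed

lemma one_minus_power_nonzero:
  fixes q :: complex
  assumes "norm q < 1"
  shows "1 - q ^ Suc n \<noteq> 0"
  using qpoch_q_q_nonzero[OF assms, of "Suc n"] by (simp add: qpoch_Suc)

lemma qpoch_nonzero_mono:
  assumes "qpoch x q n \<noteq> 0" "m \<le> n"
  shows "qpoch x q m \<noteq> 0"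
  using assms qpoch_add[of x q m "n - m"] by auto

definition qbinom :: "complex \<Rightarrow> nat \<Rightarrow> nat \<Rightarrow> complex" where
  "qbinom q n k = (if k \<le> n then qpoch q q n / (qpoch q q k * qpoch q q (n - k)) else 0)"

lemma qbinom_0_right [simp]: "norm q < 1 \<Longrightarrow> qbinom q n 0 = 1"
  by (simp add: qbinom_def qpoch_q_q_nonzero)

lemma qbinom_eq_0 [simp]: "n < k \<Longrightarrow> qbinom q n k = 0"
  by (simp add: qbinom_def)

lemma qbinom_absorb:
  assumes "norm q < 1"
  shows "(1 - q ^ Suc k) * qbinom q n (Suc k) = (1 - q ^ (n - k)) * qbinom q n k"
proof (cases "k < n")
  case True
  then obtain m where n: "n = Suc (k + m)"
    using less_iff_Suc_add by blast
  have "qpoch q q k \<noteq> 0" "qpoch q q m \<noteq> 0" "1 - q * q ^ k \<noteq> 0" "1 - q * q ^ m \<noteq> 0"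
    using assms qpoch_q_q_nonzero one_minus_power_nonzero[OF assms] by auto
  then show ?thesis
    unfolding n by (simp add: qbinom_def qpoch_Suc Suc_diff_le divide_simps)
qed (simp add: qbinom_def)

lemma qbinom_Suc_Suc:
  assumes "norm q < 1"
  shows "qbinom q (Suc n) (Suc k) = q ^ (n - k) * qbinom q n k + qbinom q n (Suc k)"
proof (cases "k < n")
  case True
  then obtain m where n: "n = Suc (k + m)"
    using less_iff_Suc_add by blast
  have "qpoch q q k \<noteq> 0" "qpoch q q m \<noteq> 0" "1 - q * q ^ k \<noteq> 0" "1 - q * q ^ m \<noteq> 0"
    using assms qpoch_q_q_nonzero one_minus_power_nonzero[OF assms] by auto
  then show ?thesis
    unfolding n by (simp add: qbinom_def qpoch_Suc Suc_diff_le divide_simps) (simp add: power_add algebra_simps)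
qed (use assms qpoch_q_q_nonzero[OF assms] in \<open>auto simp: qbinom_def\<close>)

lemma qbinom_Suc_Suc':
  assumes "norm q < 1"
  shows "qbinom q (Suc n) (Suc k) = qbinom q n k + q ^ Suc k * qbinom q n (Suc k)"
  using qbinom_Suc_Suc[OF assms, of n k] qbinom_absorb[OF assms, of k n]
  by (simp add: algebra_simps)

section \<open>Finite summation formulas\<close>

text \<open>
  Writing \<open>G M b\<close> for the left-hand side, the \<open>q\<close>-Pascal rule splits \<open>G (M + 1) b\<close> into two sums over
  \<open>m \<le> M\<close>; after the second is shifted, the coefficients of \<open>[M, m]\<close> add up to those of
  \<open>G M (b q) / (1 - b q)\<close>. This is why \<open>b\<close> varies in the induction.
\<close>
lemma finite_cauchy_identity:
  assumes q: "norm q < 1" and "qpoch (b * q) q M \<noteq> 0"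
  shows "(\<Sum>m\<le>M. b ^ m * q ^ m\<^sup>2 * qbinom q M m / qpoch (b * q) q m) = 1 / qpoch (b * q) q M"
  using assms(2)
proof (induction M arbitrary: b)
  case 0
  then show ?case by (simp add: q)
next
  case (Suc M)
  let ?f = "\<lambda>m. b ^ m * q ^ m\<^sup>2 / qpoch (b * q) q m"
  have bq: "1 - b * q \<noteq> 0" and nz: "qpoch (b * q * q) q M \<noteq> 0"
    using Suc.prems by (auto simp: qpoch_Suc_left)
  have "(\<Sum>m\<le>Suc M. b ^ m * q ^ m\<^sup>2 * qbinom q (Suc M) m / qpoch (b * q) q m)
      = 1 + (\<Sum>m\<le>M. qbinom q (Suc M) (Suc m) * ?f (Suc m))"
    by (subst sum.atMost_Suc_shift) (simp add: q mult_ac)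
  also have "\<dots> = (1 + (\<Sum>m\<le>M. q ^ Suc m * qbinom q M (Suc m) * ?f (Suc m)))
      + (\<Sum>m\<le>M. qbinom q M m * ?f (Suc m))"
    by (simp add: qbinom_Suc_Suc'[OF q] distrib_right add_divide_distrib sum.distrib del: power_Suc)
  also have "1 + (\<Sum>m\<le>M. q ^ Suc m * qbinom q M (Suc m) * ?f (Suc m))
      = (\<Sum>m\<le>Suc M. q ^ m * qbinom q M m * ?f m)"
    by (subst sum.atMost_Suc_shift) (simp add: q)
  also have "\<dots> = (\<Sum>m\<le>M. q ^ m * qbinom q M m * ?f m)"
    by simp
  also have "\<dots> + (\<Sum>m\<le>M. qbinom q M m * ?f (Suc m))
      = (\<Sum>m\<le>M. (b * q) ^ m * q ^ m\<^sup>2 * qbinom q M m / qpoch (b * q * q) q m / (1 - b * q))"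
    unfolding sum.distrib [symmetric]
  proof (rule sum.cong)
    fix m assume m: "m \<in> {..M}"
    have nz1: "qpoch (b * q * q) q m \<noteq> 0"
      using m qpoch_nonzero_mono[OF nz] by simp
    have "qpoch (b * q) q (Suc m) \<noteq> 0"
      using m qpoch_nonzero_mono[OF Suc.prems] by simp
    then have nz2: "qpoch (b * q) q m \<noteq> 0" "1 - b * q * q ^ m \<noteq> 0"
      by (auto simp: qpoch_Suc)
    have eq: "qpoch (b * q) q m * (1 - b * q * q ^ m) = (1 - b * q) * qpoch (b * q * q) q m"
      by (metis qpoch_Suc qpoch_Suc_left)
    have fS: "?f (Suc m) = b * q * q ^ m * (q ^ m * ?f m) / (1 - b * q * q ^ m)"
      using nz2 by (simp add: qpoch_Suc power2_eq_square power_add mult_ac)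
    have "q ^ m * qbinom q M m * ?f m + qbinom q M m * ?f (Suc m)
        = qbinom q M m * (q ^ m * ?f m) / (1 - b * q * q ^ m)"
      unfolding fS using nz2 by (simp add: divide_simps) (simp add: algebra_simps)
    also have "\<dots> = (b * q) ^ m * q ^ m\<^sup>2 * qbinom q M m
        / (qpoch (b * q) q m * (1 - b * q * q ^ m))"
      by (simp add: power_mult_distrib mult_ac)
    also have "\<dots> = (b * q) ^ m * q ^ m\<^sup>2 * qbinom q M m / qpoch (b * q * q) q m / (1 - b * q)"
      unfolding eq by (simp add: mult_ac)
    finally show "q ^ m * qbinom q M m * ?f m + qbinom q M m * ?f (Suc m)
        = (b * q) ^ m * q ^ m\<^sup>2 * qbinom q M m / qpoch (b * q * q) q m / (1 - b * q)" .
  qed simp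
  also have "\<dots> = 1 / qpoch (b * q) q (Suc M)"
    unfolding sum_divide_distrib [symmetric] Suc.IH[OF nz] by (simp add: qpoch_Suc_left)
  finally show ?case .
qed

text \<open>
  The \<open>\<alpha>\<close> of the unit Bailey pair relative to \<open>a\<close>, whose \<open>\<beta>\<close> is \<open>1\<close> at index \<open>0\<close> and \<open>0\<close> elsewhere.
\<close>
definition unit_alpha :: "complex \<Rightarrow> complex \<Rightarrow> nat \<Rightarrow> complex" where
  "unit_alpha a q r = (- 1) ^ r * q ^ (r choose 2) * (1 - a * q ^ (2 * r)) * qpoch a q r
     / ((1 - a) * qpoch q q r)"

lemma Suc_choose_2: "Suc r choose 2 = r + (r choose 2)"
  by (simp add: numeral_2_eq_2)

text \<open>
  A Wilf-Zeilberger proof: the difference of the summands for \<open>n + 1\<close> and \<open>n\<close> equals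
  \<open>g (r + 1) - g r\<close> for an explicit \<open>g\<close> that vanishes at \<open>r = 0\<close> and at \<open>r = n + 2\<close>.
\<close>
lemma unit_pair_sum_eq_1:
  assumes q: "norm q < 1" and a: "a \<noteq> 1" and nz: "\<And>n. qpoch (a * q) q n \<noteq> 0"
  defines "c \<equiv> \<lambda>r. (- a) ^ r * q ^ (r\<^sup>2 + (r choose 2)) * qpoch a q r / (1 - a)"
  shows "(\<Sum>r\<le>n. c r * (1 - a * q ^ (2 * r)) * qbinom q n r / qpoch (a * q) q (n + r)) = 1"
proof (induction n)
  case 0
  then show ?case using a by (simp add: c_def q numeral_2_eq_2)
next
  case (Suc n)
  define t where "t = (\<lambda>n r. c r * (1 - a * q ^ (2 * r)) * qbinom q n r / qpoch (a * q) q (n + r))"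
  define g where "g = (\<lambda>r. case r of 0 \<Rightarrow> 0 | Suc k \<Rightarrow>
    - c (Suc k) * q ^ (n - k) * qbinom q n k / qpoch (a * q) q (n + Suc k))"
  have c_Suc: "c (Suc r) = - a * (1 - a * q ^ r) * (q ^ r) ^ 3 * q * c r" for r
    by (simp add: c_def qpoch_Suc Suc_choose_2 power2_eq_square power3_eq_cube power_add)
  have step: "t (Suc n) r - t n r = g (Suc r) - g r" for r
  proof (cases r)
    case 0
    have "qpoch (a * q) q n \<noteq> 0" "1 - a * q * q ^ n \<noteq> 0"
      using nz[of "Suc n"] by (auto simp: qpoch_Suc)
    then show ?thesis
      using a unfolding 0
      by (simp add: t_def g_def c_def q qpoch_Suc numeral_2_eq_2 divide_simps)
  next
    case (Suc k)
    \<comment> \<open>In these variables the claim is a polynomial identity modulo the absorption rule for \<open>B\<close> and \<open>B'\<close>.\<close>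
    define B where "B = qbinom q n k"
    define B' where "B' = qbinom q n (Suc k)"
    define X where "X = q ^ Suc k"
    define Y where "Y = q ^ (n - k)"
    define W where "W = qpoch (a * q) q (Suc (n + k))"
    define Z where "Z = 1 - a * q * q ^ Suc (n + k)"
    have W_Suc: "qpoch (a * q) q (Suc (Suc (n + k))) = W * Z"
      by (simp add: W_def Z_def qpoch_Suc)
    have WZ: "W \<noteq> 0" "Z \<noteq> 0"
      using nz[of "Suc (Suc (n + k))"] unfolding W_Suc by auto
    show ?thesis
    proof (cases "k \<le> n")
      case True
      have "Suc k + Suc k + (n - k) = Suc (Suc (n + k))"
        using True by simp
      then have "q * q ^ Suc (n + k) = X * X * Y"
        by (metis X_def Y_def power_add power_Suc)
      then have Z: "Z = 1 - a * (X * X * Y)"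
        by (simp add: Z_def mult.assoc)
      have rel: "(1 - X) * B' = (1 - Y) * B"
        unfolding X_def Y_def B_def B'_def by (rule qbinom_absorb[OF q])
      \<comment> \<open>The subtraction truncates only for \<open>k = n\<close>, where \<open>B'\<close> vanishes.\<close>
      have qY: "q * q ^ (n - Suc k) * B' = Y * B'"
      proof (cases "k < n")
        case True
        then have "n - k = Suc (n - Suc k)" by simp
        then show ?thesis by (simp add: Y_def)
      qed (simp add: B'_def)
      have t1: "t (Suc n) (Suc k) = c (Suc k) * (1 - a * (X * X)) * (Y * B + B') / (W * Z)"
        unfolding t_def qbinom_Suc_Suc[OF q] add_Suc add_Suc_right W_Suc
        by (simp add: X_def Y_def B_def B'_def power_mult power2_eq_square mult_2 power_add mult_ac)
      have t2: "t n (Suc k) = c (Suc k) * (1 - a * (X * X)) * B' / W"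
        unfolding t_def add_Suc_right W_def
        by (simp add: X_def B'_def power_mult power2_eq_square mult_2 power_add mult_ac)
      have "g (Suc (Suc k)) = a * (1 - a * X) * X ^ 3 * c (Suc k) * (q * q ^ (n - Suc k) * B') / (W * Z)"
        unfolding g_def nat.case add_Suc_right W_Suc c_Suc[of "Suc k"] X_def [symmetric]
          B'_def [symmetric] by (simp add: mult_ac)
      then have g1: "g (Suc (Suc k)) = a * (1 - a * X) * X ^ 3 * c (Suc k) * (Y * B') / (W * Z)"
        unfolding qY .
      have g2: "g (Suc k) = - c (Suc k) * Y * B / W"
        by (simp add: g_def Y_def B_def W_def)
      have key: "(1 - a * (X * X)) * (Y * B + B') - (1 - a * (X * X)) * B' * Z
          = a * (1 - a * X) * X ^ 3 * (Y * B') + Y * B * Z"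
        using rel unfolding Z by algebra
      have "t (Suc n) (Suc k) - t n (Suc k)
         = c (Suc k) * ((1 - a * (X * X)) * (Y * B + B') - (1 - a * (X * X)) * B' * Z) / (W * Z)"
        unfolding t1 t2 using WZ by (simp add: divide_simps) (simp add: algebra_simps)
      also have "\<dots> = g (Suc (Suc k)) - g (Suc k)"
        unfolding key g1 g2 using WZ by (simp add: divide_simps) (simp add: algebra_simps)
      finally show ?thesis unfolding Suc .
    qed (simp add: t_def g_def Suc)
  qed
  have "(\<Sum>r\<le>Suc n. t (Suc n) r) - (\<Sum>r\<le>Suc n. t n r) = (\<Sum>r<Suc (Suc n). g (Suc r) - g r)"
    unfolding sum_subtractf [symmetric] step lessThan_Suc_atMost ..
  also have "\<dots> = g (Suc (Suc n)) - g 0"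
    by (rule sum_lessThan_telescope)
  also have "\<dots> = 0"
    by (simp add: g_def)
  finally have "(\<Sum>r\<le>Suc n. t (Suc n) r) = (\<Sum>r\<le>n. t n r)"
    by (simp add: t_def)
  then show ?case
    using Suc.IH by (simp add: t_def)
qed

text \<open>
  The Bailey pair obtained from the unit pair by one application of the Bailey lemma. Both sides of the
  preceding identity are divided by \<open>(q;q)\<^sub>n\<close>.
\<close>
lemma unit_pair_step:
  assumes q: "norm q < 1" and a: "a \<noteq> 1" and nz: "\<And>n. qpoch (a * q) q n \<noteq> 0"
  shows "(\<Sum>r\<le>n. a ^ r * q ^ r\<^sup>2 * unit_alpha a q r
            / (qpoch q q (n - r) * qpoch (a * q) q (n + r))) = 1 / qpoch q q n"
proof -
  have "(\<Sum>r\<le>n. a ^ r * q ^ r\<^sup>2 * unit_alpha a q r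
            / (qpoch q q (n - r) * qpoch (a * q) q (n + r)))
      = (\<Sum>r\<le>n. (- a) ^ r * q ^ (r\<^sup>2 + (r choose 2)) * qpoch a q r / (1 - a)
            * (1 - a * q ^ (2 * r)) * qbinom q n r / qpoch (a * q) q (n + r) / qpoch q q n)"
    using qpoch_q_q_nonzero[OF q]
    by (intro sum.cong) (simp_all add: unit_alpha_def qbinom_def power_add power_minus[of a] mult_ac)
  then show ?thesis
    using unit_pair_sum_eq_1[OF assms, of n] unfolding sum_divide_distrib [symmetric] by simp
qed

lemma recip_qpoch_of_nat [simp]: "recip_qpoch q (int n) = 1 / qpoch q q n"
  by (simp add: recip_qpoch_def)

lemma recip_qpoch_neg [simp]: "m < 0 \<Longrightarrow> recip_qpoch q m = 0"
  by (simp add: recip_qpoch_def)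

text \<open>
  Since \<open>(q;q)\<^sub>N / (q;q)\<^bsub>N-2k\<^esub>\<close> is, up to a power of \<open>q\<close>, \<open>(q\<^bsup>-N\<^esup>;q)\<^bsub>2k\<^esub>\<close>, this is the terminating \<open>q\<close>-Gauss sum in base \<open>q\<^sup>2\<close> with numerator
  parameters \<open>q\<^bsup>-N\<^esup>\<close>, \<open>q\<^bsup>1-N\<^esup>\<close> and denominator parameter \<open>b q\<^sup>2\<close>. The closed form satisfies a first-order
  recurrence in \<open>N\<close>, and the sum satisfies the same one because the difference of its summands telescopes
  in \<open>k\<close>. The range is any \<open>k < K\<close> that covers the support, so that it does not change with \<open>N\<close>.
\<close>
lemma q_gauss_quadratic:
  assumes q: "norm q < 1" and nz: "\<And>n. qpoch (b * q) q n \<noteq> 0"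
  assumes K: "N < 2 * K"
  shows "(\<Sum>k<K. b ^ k * q ^ (2 * k\<^sup>2) * recip_qpoch q (int N - 2 * int k)
            / (qpoch (q\<^sup>2) (q\<^sup>2) k * qpoch (b * q\<^sup>2) (q\<^sup>2) k))
       = qpoch (b * q) (q\<^sup>2) N / (qpoch q q N * qpoch (b * q) q N)"
  using K
proof (induction N)
  case 0
  have "(\<Sum>k<K. b ^ k * q ^ (2 * k\<^sup>2) * recip_qpoch q (int 0 - 2 * int k)
            / (qpoch (q\<^sup>2) (q\<^sup>2) k * qpoch (b * q\<^sup>2) (q\<^sup>2) k))
      = (\<Sum>k\<in>{0}. b ^ k * q ^ (2 * k\<^sup>2) * recip_qpoch q (int 0 - 2 * int k)
            / (qpoch (q\<^sup>2) (q\<^sup>2) k * qpoch (b * q\<^sup>2) (q\<^sup>2) k))"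
    using 0 by (intro sum.mono_neutral_right) auto
  then show ?case by (simp add: recip_qpoch_def)
next
  case (Suc N)
  define P where "P = (\<lambda>k. b ^ k * q ^ (2 * k\<^sup>2) / (qpoch (q\<^sup>2) (q\<^sup>2) k * qpoch (b * q\<^sup>2) (q\<^sup>2) k))"
  define R where "R = (\<lambda>N k. recip_qpoch q (int N - 2 * int k))"
  \<comment> \<open>The certificate of the recurrence. Where the exponent truncates, \<open>R (Suc N) k\<close> is \<open>0\<close>.\<close>
  define g where "g = (\<lambda>k. - (P k * q ^ (Suc N - 2 * k) * R (Suc N) k
                        * (1 - q ^ (2 * k)) * (1 - b * q ^ (2 * k))))"
  have q2: "norm (q\<^sup>2) < 1"
    using q by (simp add: norm_power power_less_one_iff)
  have nz2: "qpoch (b * q\<^sup>2) (q\<^sup>2) n \<noteq> 0" for n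
    using nz[of "2 * n"] qpoch_double[of "b * q" q n] by (simp add: power2_eq_square mult_ac)
  have P_Suc: "P (Suc k) * (1 - q ^ (2 * Suc k)) * (1 - b * q ^ (2 * Suc k))
      = b * q ^ (4 * k + 2) * P k" for k
    using nz2[of k] nz2[of "Suc k"] qpoch_q_q_nonzero[OF q2, of k] qpoch_q_q_nonzero[OF q2, of "Suc k"]
    by (simp add: P_def qpoch_Suc power_mult [symmetric] divide_simps)
       (simp add: power2_eq_square power_add algebra_simps power_mult [symmetric])
  have step: "(1 - b * q ^ Suc N) * (1 - q ^ Suc N) * (P k * R (Suc N) k)
      - (1 - b * q ^ (2 * N + 1)) * (P k * R N k) = g (Suc k) - g k" for k
  proof -
    have g_Suc: "g (Suc k) = - (b * q ^ (4 * k + 2) * P k * q ^ (Suc N - 2 * Suc k) * R (Suc N) (Suc k))"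
      using P_Suc[of k] by (simp add: g_def mult_ac)
    consider (le) "2 * k \<le> N" | (eq) "2 * k = Suc N" | (gt) "Suc N < 2 * k"
      by linarith
    then show ?thesis
    proof cases
      case le
      define m where "m = N - 2 * k"
      define X where "X = q ^ m"
      define x where "x = q ^ (2 * k)"
      have N: "N = m + 2 * k" using le by (simp add: m_def)
      have R1: "R (Suc N) k = R N k / (1 - q * X)"
      proof -
        have "int (Suc N) - 2 * int k = int (Suc m)" "int N - 2 * int k = int m"
          using N by auto
        then show ?thesis
          unfolding R_def by (simp only: recip_qpoch_of_nat qpoch_Suc X_def) simp
      qed
      have R2: "q * q ^ (Suc N - 2 * Suc k) * R (Suc N) (Suc k) = X * (1 - X) * R N k"
      proof (cases m)
        case 0
        then show ?thesis by (simp add: R_def N X_def)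
      next
        case (Suc l)
        have e: "int (Suc N) - 2 * int (Suc k) = int l" "int N - 2 * int k = int (Suc l)"
          "Suc N - 2 * Suc k = l"
          using N Suc by auto
        have "1 - q * q ^ l \<noteq> 0" using one_minus_power_nonzero[OF q] by simp
        then show ?thesis
          unfolding R_def e recip_qpoch_of_nat qpoch_Suc X_def Suc by simp
      qed
      have qN: "q ^ N = X * x"
        by (simp add: N X_def x_def power_add)
      have nzX: "1 - q * X \<noteq> 0"
        unfolding X_def using one_minus_power_nonzero[OF q] by simp
      have "Suc N - 2 * k = Suc m" using N by simp
      then have gk: "g k = - (P k * (q * X) * R N k / (1 - q * X) * (1 - x) * (1 - b * x))"
        by (simp add: g_def R1 x_def X_def mult_ac)
      have "g (Suc k) = - (b * (q * (x * x)) * P k * (q * q ^ (Suc N - 2 * Suc k) * R (Suc N) (Suc k)))"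
        unfolding g_Suc by (simp add: x_def power_add [symmetric] mult_ac)
      then have gS: "g (Suc k) = - (b * (q * (x * x)) * P k * (X * (1 - X) * R N k))"
        unfolding R2 .
      have q2N: "q ^ (2 * N + 1) = q * (X * x) * (X * x)"
        by (simp add: mult_2 power_add qN)
      show ?thesis
        unfolding gS gk R1 q2N power_Suc qN using nzX
        by (simp add: divide_simps) (simp add: algebra_simps)
    next
      case eq
      then have "int (Suc N) - 2 * int k = 0" by simp
      then have R: "R (Suc N) k = 1" "R N k = 0" "R (Suc N) (Suc k) = 0"
        by (simp_all add: R_def recip_qpoch_def)
      show ?thesis
        unfolding g_Suc unfolding g_def by (simp add: R eq del: power_Suc)
    next
      case gt
      then have R: "R (Suc N) k = 0" "R N k = 0" "R (Suc N) (Suc k) = 0"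
        by (simp_all add: R_def)
      show ?thesis
        unfolding g_Suc unfolding g_def by (simp add: R)
    qed
  qed
  have "(1 - b * q ^ Suc N) * (1 - q ^ Suc N) * (\<Sum>k<K. P k * R (Suc N) k)
      - (1 - b * q ^ (2 * N + 1)) * (\<Sum>k<K. P k * R N k) = (\<Sum>k<K. g (Suc k) - g k)"
    unfolding step [symmetric] sum_subtractf sum_distrib_left ..
  also have "\<dots> = g K - g 0"
    by (rule sum_lessThan_telescope)
  also have "\<dots> = 0"
    using Suc.prems by (simp add: g_def R_def)
  finally have rec: "(1 - b * q ^ Suc N) * (1 - q ^ Suc N) * (\<Sum>k<K. P k * R (Suc N) k)
      = (1 - b * q ^ (2 * N + 1)) * (\<Sum>k<K. P k * R N k)"
    by simp
  have IH: "(\<Sum>k<K. P k * R N k) = qpoch (b * q) (q\<^sup>2) N / (qpoch q q N * qpoch (b * q) q N)"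
    using Suc by (simp add: P_def R_def)
  have n1: "1 - b * q ^ Suc N \<noteq> 0"
    using nz[of "Suc N"] by (simp add: qpoch_Suc mult_ac)
  have n2: "1 - q ^ Suc N \<noteq> 0"
    by (rule one_minus_power_nonzero[OF q])
  have "(\<Sum>k<K. P k * R (Suc N) k)
      = (1 - b * q ^ (2 * N + 1)) * (\<Sum>k<K. P k * R N k) / ((1 - b * q ^ Suc N) * (1 - q ^ Suc N))"
    unfolding rec [symmetric] using n1 n2 by (simp del: power_Suc)
  also have "\<dots> = qpoch (b * q) (q\<^sup>2) (Suc N) / (qpoch q q (Suc N) * qpoch (b * q) q (Suc N))"
    unfolding IH by (simp add: qpoch_Suc power_mult [symmetric] mult_ac)
  finally show ?case
    by (simp add: P_def R_def)
qed

lemma qpoch_square_nonzero: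
  assumes "\<And>n. qpoch (a * q) q n \<noteq> 0"
  shows "qpoch (a * q) (q\<^sup>2) n \<noteq> 0" "qpoch (a * q\<^sup>2) (q\<^sup>2) n \<noteq> 0"
  using assms[of "2 * n"] qpoch_double[of "a * q" q n] by (simp_all add: power2_eq_square mult_ac)

section \<open>The change of base\<close>

text \<open>
  The shift \<open>r = k + s\<close>, \<open>N = n - 2 s\<close>, \<open>b = a q\<^bsup>4s\<^esup>\<close> reduces the sum to \<open>q_gauss_quadratic\<close>; the remaining
  factors match because \<open>(aq;q)\<^bsub>4s\<^esub>\<close> splits into its odd and even halves in base \<open>q\<^sup>2\<close>.
\<close>
lemma base_change_kernel:
  assumes q: "norm q < 1" and nz: "\<And>n. qpoch (a * q) q n \<noteq> 0" and s: "s \<le> n"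
  shows "(\<Sum>r=s..n. a ^ r * q ^ (2 * r\<^sup>2) * recip_qpoch q (int n - 2 * int r)
            / (qpoch (q\<^sup>2) (q\<^sup>2) (r - s) * qpoch (a * q\<^sup>2) (q\<^sup>2) (r + s)))
       = qpoch (a * q) (q\<^sup>2) n * (a ^ s * q ^ (2 * s\<^sup>2) * recip_qpoch q (int n - 2 * int s)
            / qpoch (a * q) q (n + 2 * s))"
proof (cases "2 * s \<le> n")
  case False
  then show ?thesis by (simp add: sum.neutral)
next
  case True
  define N where "N = n - 2 * s"
  define b where "b = a * q ^ (4 * s)"
  have n: "n = N + 2 * s" using True by (simp add: N_def)
  have nzb: "qpoch (b * q) q m \<noteq> 0" for m
    using nz[of "4 * s + m"] qpoch_add[of "a * q" q "4 * s" m] by (simp add: b_def mult_ac)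
  have split_even: "qpoch (a * q\<^sup>2) (q\<^sup>2) (k + 2 * s)
      = qpoch (a * q\<^sup>2) (q\<^sup>2) (2 * s) * qpoch (b * q\<^sup>2) (q\<^sup>2) k" for k
    using qpoch_add[of "a * q\<^sup>2" "q\<^sup>2" "2 * s" k]
    by (simp add: b_def power_mult [symmetric] mult_ac add_ac)
  have split_odd: "qpoch (a * q) (q\<^sup>2) n = qpoch (a * q) (q\<^sup>2) (2 * s) * qpoch (b * q) (q\<^sup>2) N"
    using qpoch_add[of "a * q" "q\<^sup>2" "2 * s" N]
    by (simp add: n b_def power_mult [symmetric] mult_ac add_ac)
  have split_all: "qpoch (a * q) q (n + 2 * s) = qpoch (a * q) (q\<^sup>2) (2 * s)
      * qpoch (a * q\<^sup>2) (q\<^sup>2) (2 * s) * qpoch (b * q) q N"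
    using qpoch_add[of "a * q" q "4 * s" N] qpoch_double[of "a * q" q "2 * s"]
    by (simp add: n b_def power2_eq_square mult_ac add_ac)
  have "(\<Sum>r=s..n. a ^ r * q ^ (2 * r\<^sup>2) * recip_qpoch q (int n - 2 * int r)
            / (qpoch (q\<^sup>2) (q\<^sup>2) (r - s) * qpoch (a * q\<^sup>2) (q\<^sup>2) (r + s)))
      = (\<Sum>k<Suc n - s. a ^ s * q ^ (2 * s\<^sup>2) / qpoch (a * q\<^sup>2) (q\<^sup>2) (2 * s)
          * (b ^ k * q ^ (2 * k\<^sup>2) * recip_qpoch q (int N - 2 * int k)
            / (qpoch (q\<^sup>2) (q\<^sup>2) k * qpoch (b * q\<^sup>2) (q\<^sup>2) k)))"
  proof (rule sum.reindex_bij_witness[of _ "\<lambda>k. k + s" "\<lambda>r. r - s"])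
    fix r assume r: "r \<in> {s..n}"
    define k where "k = r - s"
    have rk: "r = k + s" using r by (simp add: k_def)
    have e1: "a ^ r * q ^ (2 * r\<^sup>2) = a ^ s * q ^ (2 * s\<^sup>2) * (b ^ k * q ^ (2 * k\<^sup>2))"
    proof -
      have "2 * r\<^sup>2 = 2 * s\<^sup>2 + (4 * s * k + 2 * k\<^sup>2)"
        by (simp add: rk power2_eq_square algebra_simps)
      then have "q ^ (2 * r\<^sup>2) = q ^ (2 * s\<^sup>2) * ((q ^ (4 * s)) ^ k * q ^ (2 * k\<^sup>2))"
        by (simp only: power_add power_mult [symmetric])
      then show ?thesis
        by (simp add: b_def rk power_add power_mult_distrib mult_ac)
    qed
    have e2: "int N - 2 * int k = int n - 2 * int r"
      by (simp add: n rk)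
    have e3: "qpoch (a * q\<^sup>2) (q\<^sup>2) (r + s)
       = qpoch (a * q\<^sup>2) (q\<^sup>2) (2 * s) * qpoch (b * q\<^sup>2) (q\<^sup>2) k"
      using split_even[of k] by (simp add: rk mult_2 add_ac)
    show "a ^ s * q ^ (2 * s\<^sup>2) / qpoch (a * q\<^sup>2) (q\<^sup>2) (2 * s)
          * (b ^ (r - s) * q ^ (2 * (r - s)\<^sup>2) * recip_qpoch q (int N - 2 * int (r - s))
            / (qpoch (q\<^sup>2) (q\<^sup>2) (r - s) * qpoch (b * q\<^sup>2) (q\<^sup>2) (r - s)))
        = a ^ r * q ^ (2 * r\<^sup>2) * recip_qpoch q (int n - 2 * int r)
            / (qpoch (q\<^sup>2) (q\<^sup>2) (r - s) * qpoch (a * q\<^sup>2) (q\<^sup>2) (r + s))"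
      unfolding k_def [symmetric] e1 e2 e3 by (simp add: mult_ac)
  qed auto
  also have "\<dots> = a ^ s * q ^ (2 * s\<^sup>2) / qpoch (a * q\<^sup>2) (q\<^sup>2) (2 * s)
      * (qpoch (b * q) (q\<^sup>2) N / (qpoch q q N * qpoch (b * q) q N))"
    unfolding sum_distrib_left [symmetric]
    by (subst q_gauss_quadratic[OF q nzb]) (use True in \<open>auto simp: N_def\<close>)
  also have "\<dots> = qpoch (a * q) (q\<^sup>2) n * (a ^ s * q ^ (2 * s\<^sup>2) * recip_qpoch q (int n - 2 * int s)
            / qpoch (a * q) q (n + 2 * s))"
  proof -
    have "int n - 2 * int s = int N" by (simp add: n)
    then show ?thesis
      unfolding split_odd split_all using qpoch_square_nonzero(1)[OF nz, of "2 * s"]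
      by (simp add: mult_ac)
  qed
  finally show ?thesis .
qed

text \<open>
  Expanding \<open>1 / (q\<^sup>2;q\<^sup>2)\<^sub>r\<close> by \<open>unit_pair_step\<close> in base \<open>q\<^sup>2\<close> and exchanging the two finite sums leaves, for
  each \<open>s\<close>, a sum over \<open>r\<close> evaluated by \<open>base_change_kernel\<close>.
\<close>
lemma inner_sum_expansion:
  assumes q: "norm q < 1" and a: "a \<noteq> 1" and nz: "\<And>n. qpoch (a * q) q n \<noteq> 0"
  shows "(\<Sum>r\<le>n. lhs_term a q n r)
       = (\<Sum>s\<le>n. a ^ (2 * s) * q ^ (4 * s\<^sup>2) * unit_alpha a (q\<^sup>2) s
            * (a ^ n * q ^ n\<^sup>2 * recip_qpoch q (int n - 2 * int s) / qpoch (a * q) q (n + 2 * s)))"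
proof -
  let ?K = "\<lambda>r s. a ^ r * q ^ (2 * r\<^sup>2) * recip_qpoch q (int n - 2 * int r)
            / (qpoch (q\<^sup>2) (q\<^sup>2) (r - s) * qpoch (a * q\<^sup>2) (q\<^sup>2) (r + s))"
  let ?c = "a ^ n * q ^ n\<^sup>2 / qpoch (a * q) (q\<^sup>2) n"
  let ?A = "\<lambda>s. a ^ s * q ^ (2 * s\<^sup>2) * unit_alpha a (q\<^sup>2) s"
  have q2: "norm (q\<^sup>2) < 1"
    using q by (simp add: norm_power power_less_one_iff)
  note nz2 = qpoch_square_nonzero[OF nz]
  have "(\<Sum>r\<le>n. lhs_term a q n r) = (\<Sum>r\<le>n. \<Sum>s\<le>r. ?c * ?A s * ?K r s)"
  proof (rule sum.cong)
    fix r
    have "lhs_term a q n r = ?c * (a ^ r * q ^ (2 * r\<^sup>2) * recip_qpoch q (int n - 2 * int r))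
        * (1 / qpoch (q\<^sup>2) (q\<^sup>2) r)"
      by (simp add: lhs_term_def power_add)
    also have "1 / qpoch (q\<^sup>2) (q\<^sup>2) r = (\<Sum>s\<le>r. ?A s
        / (qpoch (q\<^sup>2) (q\<^sup>2) (r - s) * qpoch (a * q\<^sup>2) (q\<^sup>2) (r + s)))"
      using unit_pair_step[OF q2 a nz2(2), of r] by (simp add: power_mult)
    finally show "lhs_term a q n r = (\<Sum>s\<le>r. ?c * ?A s * ?K r s)"
      by (simp add: sum_distrib_left mult_ac)
  qed simp
  also have "\<dots> = (\<Sum>s\<le>n. \<Sum>r=s..n. ?c * ?A s * ?K r s)"
    by (subst sum.Sigma, simp, simp, subst sum.Sigma, simp, simp)
       (rule sum.reindex_bij_witness[of _ prod.swap prod.swap], auto)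
  also have "\<dots> = (\<Sum>s\<le>n. ?c * ?A s * (qpoch (a * q) (q\<^sup>2) n * (a ^ s * q ^ (2 * s\<^sup>2)
      * recip_qpoch q (int n - 2 * int s) / qpoch (a * q) q (n + 2 * s))))"
    unfolding sum_distrib_left [symmetric]
    by (intro sum.cong) (simp_all add: base_change_kernel[OF q nz])
  also have "\<dots> = (\<Sum>s\<le>n. a ^ (2 * s) * q ^ (4 * s\<^sup>2) * unit_alpha a (q\<^sup>2) s
            * (a ^ n * q ^ n\<^sup>2 * recip_qpoch q (int n - 2 * int s) / qpoch (a * q) q (n + 2 * s)))"
  proof (rule sum.cong)
    fix s
    have "a ^ (2 * s) = a ^ s * a ^ s"
      by (simp add: power_add [symmetric] mult_2)
    moreover have "q ^ (4 * s\<^sup>2) = q ^ (2 * s\<^sup>2) * q ^ (2 * s\<^sup>2)"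
      by (simp add: power_add [symmetric])
    ultimately show "?c * ?A s * (qpoch (a * q) (q\<^sup>2) n * (a ^ s * q ^ (2 * s\<^sup>2)
      * recip_qpoch q (int n - 2 * int s) / qpoch (a * q) q (n + 2 * s)))
      = a ^ (2 * s) * q ^ (4 * s\<^sup>2) * unit_alpha a (q\<^sup>2) s
            * (a ^ n * q ^ n\<^sup>2 * recip_qpoch q (int n - 2 * int s) / qpoch (a * q) q (n + 2 * s))"
      using nz2(1)[of n] by (simp add: mult_ac)
  qed simp
  finally show ?thesis .
qed

lemma rhs_term_eq:
  "rhs_term a q s = a ^ (4 * s) * q ^ (8 * s\<^sup>2) * unit_alpha a (q\<^sup>2) s"
proof -
  have "s \<le> s\<^sup>2" by (simp add: power2_eq_square)
  moreover have "2 * (s choose 2) = s\<^sup>2 - s"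
    by (simp add: choose_two power2_eq_square algebra_simps)
  ultimately have "9 * s\<^sup>2 - s = 8 * s\<^sup>2 + 2 * (s choose 2)" by simp
  then have "q ^ (9 * s\<^sup>2 - s) = q ^ (8 * s\<^sup>2) * (q\<^sup>2) ^ (s choose 2)"
    by (simp only: power_add power_mult)
  moreover have "(q\<^sup>2) ^ (2 * s) = q ^ (4 * s)"
    by (simp add: power_mult [symmetric])
  ultimately show ?thesis
    unfolding rhs_term_def unit_alpha_def by (simp add: mult_ac)
qed

section \<open>Convergence and bounds\<close>

lemma qpoch_LIMSEQ:
  assumes "norm q < 1"
  shows "qpoch x q \<longlonglongrightarrow> qpoch_inf x q"
    and "(\<And>n. qpoch x q n \<noteq> 0) \<Longrightarrow> qpoch_inf x q \<noteq> 0"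
proof -
  have "summable (\<lambda>j. norm x * norm q ^ j)"
    using assms by (intro summable_mult summable_geometric) simp
  then have conv: "convergent_prod (\<lambda>j. 1 - x * q ^ j)"
    by (intro abs_convergent_prod_imp_convergent_prod summable_imp_abs_convergent_prod)
       (simp add: norm_mult norm_power)
  have "(\<lambda>n. qpoch x q (Suc n)) \<longlonglongrightarrow> qpoch_inf x q"
    using convergent_prod_LIMSEQ[OF conv] unfolding qpoch_def qpoch_inf_def lessThan_Suc_atMost .
  then show "qpoch x q \<longlonglongrightarrow> qpoch_inf x q"
    by (rule LIMSEQ_imp_Suc)
  show "qpoch_inf x q \<noteq> 0" if "\<And>n. qpoch x q n \<noteq> 0"
    unfolding qpoch_inf_def
  proof (rule prodinf_nonzero[OF conv])
    show "1 - x * q ^ j \<noteq> 0" for j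
      using that[of "Suc j"] by (auto simp: qpoch_Suc)
  qed
qed

lemma qpoch_nonzero_if_qpoch_inf_nonzero:
  assumes "norm q < 1" "qpoch_inf x q \<noteq> 0"
  shows "qpoch x q n \<noteq> 0"
proof
  assume z: "qpoch x q n = 0"
  have "\<forall>\<^sub>F m in sequentially. qpoch x q m = 0"
    using eventually_ge_at_top[of n]
    by eventually_elim (use z qpoch_nonzero_mono in blast)
  then have "qpoch x q \<longlonglongrightarrow> 0"
    by (rule tendsto_eventually)
  with qpoch_LIMSEQ(1)[OF assms(1)] show False
    using assms(2) LIMSEQ_unique by blast
qed

lemma qpoch_inf_split:
  assumes "norm q < 1"
  shows "qpoch_inf x q = qpoch x q m * qpoch_inf (x * q ^ m) q"
proof (rule LIMSEQ_unique)
  show "(\<lambda>n. qpoch x q (n + m)) \<longlonglongrightarrow> qpoch_inf x q"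
    by (rule LIMSEQ_ignore_initial_segment[OF qpoch_LIMSEQ(1)[OF assms]])
  show "(\<lambda>n. qpoch x q (n + m)) \<longlonglongrightarrow> qpoch x q m * qpoch_inf (x * q ^ m) q"
    unfolding add.commute[of _ m] qpoch_add
    by (intro tendsto_intros qpoch_LIMSEQ assms)
qed

lemma qpoch_bounded:
  assumes "norm q < 1"
  obtains B where "\<And>n. norm (qpoch x q n) \<le> B" "0 \<le> B"
  using convergent_imp_Bseq[OF convergentI[OF qpoch_LIMSEQ(1)[OF assms, of x]]]
  unfolding Bseq_def by (metis less_imp_le)

lemma recip_qpoch_bounded:
  assumes "norm q < 1" "\<And>n. qpoch x q n \<noteq> 0"
  obtains B where "\<And>n. norm (1 / qpoch x q n) \<le> B" "0 \<le> B"
proof -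
  have "(\<lambda>n. 1 / qpoch x q n) \<longlonglongrightarrow> 1 / qpoch_inf x q"
    by (intro tendsto_intros qpoch_LIMSEQ assms)
  from convergent_imp_Bseq[OF convergentI[OF this]] show ?thesis
    using that unfolding Bseq_def by (metis less_imp_le)
qed

lemma recip_qpoch_int_bounded:
  assumes "norm q < 1"
  obtains B where "\<And>m. norm (recip_qpoch q m) \<le> B" "0 \<le> B"
proof -
  obtain B where "\<And>n. norm (1 / qpoch q q n) \<le> B" "0 \<le> B"
    using recip_qpoch_bounded[OF assms, of q] qpoch_q_q_nonzero[OF assms] by metis
  then show ?thesis
    by (intro that[of B]) (auto simp: recip_qpoch_def)
qed

text \<open>
  The summand is \<open>(x y\<^sup>n)\<^sup>n\<close>, and \<open>x y\<^sup>n\<close> is eventually below \<open>1/2\<close>, however large \<open>x\<close> is.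
\<close>
lemma summable_power_mult_power_square:
  fixes x y :: real
  assumes "0 \<le> x" "0 \<le> y" "y < 1"
  shows "summable (\<lambda>n. x ^ n * y ^ n\<^sup>2)"
proof (rule summable_comparison_test_ev)
  have "(\<lambda>n. x * y ^ n) \<longlonglongrightarrow> x * 0"
    using assms by (intro tendsto_intros LIMSEQ_power_zero) simp
  then have "\<forall>\<^sub>F n in sequentially. x * y ^ n < 1 / 2"
    by (rule order_tendstoD) simp
  then show "\<forall>\<^sub>F n in sequentially. norm (x ^ n * y ^ n\<^sup>2) \<le> (1 / 2) ^ n"
  proof eventually_elim
    case (elim n)
    have "x ^ n * y ^ n\<^sup>2 = (x * y ^ n) ^ n"
      by (simp add: power_mult_distrib power2_eq_square power_mult)
    also have "\<dots> \<le> (1 / 2) ^ n"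
      using elim assms by (intro power_mono) auto
    finally show ?case
      using assms by simp
  qed
qed simp

lemma summable_on_prod_majorant:
  fixes f :: "nat \<Rightarrow> nat \<Rightarrow> complex" and u v :: "nat \<Rightarrow> real"
  assumes "summable u" "summable v" "\<And>n. 0 \<le> u n" "\<And>n. 0 \<le> v n"
    and le: "\<And>n m. norm (f n m) \<le> u n * v m"
  shows "(\<lambda>(n, m). f n m) summable_on UNIV"
proof (rule abs_summable_summable, rule Infinite_Sum.abs_summable_on_comparison_test')
  have u: "u summable_on UNIV" and v: "v summable_on UNIV"
    using assms by (simp_all add: summable_on_UNIV_nonneg_real_iff)
  have "(\<lambda>(n, m). u n * v m) summable_on (UNIV \<times> UNIV)"
  proof (rule summable_on_SigmaI)
    show "((\<lambda>m. case (n, m) of (n, m) \<Rightarrow> u n * v m) has_sum u n * infsum v UNIV) UNIV" for n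
      using v by (simp add: has_sum_cmult_right)
    show "(\<lambda>n. u n * infsum v UNIV) summable_on UNIV"
      using u by (rule summable_on_cmult_left)
  qed (use assms in auto)
  then show "(\<lambda>(n, m). u n * v m) summable_on UNIV" by simp
  show "norm (case x of (n, m) \<Rightarrow> f n m) \<le> (case x of (n, m) \<Rightarrow> u n * v m)" for x
    using le by (cases x) simp
qed

section \<open>Cauchy's identity\<close>

text \<open>
  The limit \<open>M \<longlonglongrightarrow> \<infinity>\<close> of \<open>finite_cauchy_identity\<close>, taken under the sum by Tannery's theorem: \<open>[M, m]\<close>
  tends to \<open>1 / (q;q)\<^sub>m\<close> and is bounded uniformly in \<open>M\<close> and \<open>m\<close>.
\<close>
lemma cauchy_identity:
  assumes q: "norm q < 1" and nz: "\<And>n. qpoch (b * q) q n \<noteq> 0"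
  shows "((\<lambda>m. b ^ m * q ^ m\<^sup>2 / (qpoch q q m * qpoch (b * q) q m)) has_sum
      1 / qpoch_inf (b * q) q) UNIV"
proof -
  define f where "f = (\<lambda>m n. b ^ m * q ^ m\<^sup>2 * qbinom q n m / qpoch (b * q) q m)"
  define h where "h = (\<lambda>m. b ^ m * q ^ m\<^sup>2 / (qpoch q q m * qpoch (b * q) q m))"
  note nzq = qpoch_q_q_nonzero[OF q]
  obtain A where A: "\<And>n. norm (qpoch q q n) \<le> A" "0 \<le> A"
    using qpoch_bounded[OF q] by metis
  obtain B where B: "\<And>n. norm (1 / qpoch q q n) \<le> B" "0 \<le> B"
    using recip_qpoch_bounded[OF q nzq] by metis
  obtain C where C: "\<And>n. norm (1 / qpoch (b * q) q n) \<le> C" "0 \<le> C"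
    using recip_qpoch_bounded[OF q nz] by metis
  define M where "M = (\<lambda>m. A * B * B * C * (norm b ^ m * norm q ^ m\<^sup>2))"
  have lim: "(\<lambda>n. f m n) \<longlonglongrightarrow> h m" for m
  proof (rule LIMSEQ_offset)
    have "(\<lambda>n. b ^ m * q ^ m\<^sup>2 * (qpoch q q (n + m) / (qpoch q q m * qpoch q q n)) / qpoch (b * q) q m)
        \<longlonglongrightarrow> b ^ m * q ^ m\<^sup>2 * (qpoch_inf q q / (qpoch q q m * qpoch_inf q q)) / qpoch (b * q) q m"
      by (intro tendsto_intros qpoch_LIMSEQ LIMSEQ_ignore_initial_segment)
         (use q nz nzq qpoch_LIMSEQ(2)[OF q nzq] in auto)
    then show "(\<lambda>n. f m (n + m)) \<longlonglongrightarrow> h m"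
      using qpoch_LIMSEQ(2)[OF q nzq] by (simp add: f_def h_def qbinom_def)
  qed
  have bound: "norm (f m n) \<le> M m" for m n
  proof (cases "m \<le> n")
    case True
    have "norm (f m n) = norm b ^ m * norm q ^ m\<^sup>2 * (norm (qpoch q q n) * norm (1 / qpoch q q m)
        * norm (1 / qpoch q q (n - m)) * norm (1 / qpoch (b * q) q m))"
      using True by (simp add: f_def qbinom_def norm_mult norm_divide norm_power)
    also have "\<dots> \<le> norm b ^ m * norm q ^ m\<^sup>2 * (A * B * B * C)"
      by (intro mult_mono A B C mult_nonneg_nonneg norm_ge_zero) auto
    finally show ?thesis by (simp add: M_def mult_ac)
  qed (use A B C in \<open>simp add: f_def M_def\<close>)
  have sM: "summable M"
    unfolding M_def using q by (intro summable_mult summable_power_mult_power_square) auto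
  have tannery: "summable (\<lambda>m. norm (h m))" "(\<lambda>n. \<Sum>m. f m n) \<longlonglongrightarrow> (\<Sum>m. h m)"
    using tannerys_theorem[OF lim always_eventually sM sequentially_bot] bound by auto
  have "(\<Sum>m. f m n) = 1 / qpoch (b * q) q n" for n
  proof -
    have "(\<Sum>m. f m n) = (\<Sum>m\<le>n. f m n)"
      by (rule suminf_finite) (auto simp: f_def)
    also have "\<dots> = 1 / qpoch (b * q) q n"
      unfolding f_def by (rule finite_cauchy_identity[OF q nz])
    finally show ?thesis .
  qed
  then have "(\<lambda>n. 1 / qpoch (b * q) q n) \<longlonglongrightarrow> (\<Sum>m. h m)"
    using tannery(2) by simp
  moreover have "(\<lambda>n. 1 / qpoch (b * q) q n) \<longlonglongrightarrow> 1 / qpoch_inf (b * q) q"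
    by (intro tendsto_intros qpoch_LIMSEQ q nz)
  ultimately have "(\<Sum>m. h m) = 1 / qpoch_inf (b * q) q"
    by (rule LIMSEQ_unique)
  then have "(h has_sum 1 / qpoch_inf (b * q) q) UNIV"
    using norm_summable_imp_has_sum[OF tannery(1) summable_sums]
      summable_norm_cancel[OF tannery(1)] by simp
  then show ?thesis unfolding h_def .
qed

text \<open>
  Only \<open>n \<ge> 2 s\<close> contributes; with \<open>n = m + 2 s\<close> this is Cauchy's identity for \<open>b = a q\<^bsup>4s\<^esup>\<close>.
\<close>
lemma shifted_cauchy_identity:
  assumes q: "norm q < 1" and nz: "\<And>n. qpoch (a * q) q n \<noteq> 0"
  shows "((\<lambda>n. a ^ n * q ^ n\<^sup>2 * recip_qpoch q (int n - 2 * int s) / qpoch (a * q) q (n + 2 * s))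
      has_sum a ^ (2 * s) * q ^ (4 * s\<^sup>2) / qpoch_inf (a * q) q) UNIV"
proof -
  define f where
    "f = (\<lambda>n. a ^ n * q ^ n\<^sup>2 * recip_qpoch q (int n - 2 * int s) / qpoch (a * q) q (n + 2 * s))"
  define b where "b = a * q ^ (4 * s)"
  have bq: "a * q * q ^ (4 * s) = b * q" by (simp add: b_def)
  have nzb: "qpoch (b * q) q m \<noteq> 0" for m
    using nz[of "4 * s + m"] qpoch_add[of "a * q" q "4 * s" m] by (simp add: bq)
  have "((\<lambda>m. a ^ (2 * s) * q ^ (4 * s\<^sup>2) / qpoch (a * q) q (4 * s)
          * (b ^ m * q ^ m\<^sup>2 / (qpoch q q m * qpoch (b * q) q m)))
      has_sum a ^ (2 * s) * q ^ (4 * s\<^sup>2) / qpoch (a * q) q (4 * s) * (1 / qpoch_inf (b * q) q)) UNIV"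
    by (intro has_sum_cmult_right cauchy_identity q nzb)
  also have "(\<lambda>m. a ^ (2 * s) * q ^ (4 * s\<^sup>2) / qpoch (a * q) q (4 * s)
          * (b ^ m * q ^ m\<^sup>2 / (qpoch q q m * qpoch (b * q) q m))) = f \<circ> (\<lambda>m. m + 2 * s)"
  proof
    fix m
    have "(m + 2 * s)\<^sup>2 = 4 * s\<^sup>2 + (4 * s * m + m\<^sup>2)"
      by (simp add: power2_eq_square algebra_simps)
    then have "q ^ (m + 2 * s)\<^sup>2 = q ^ (4 * s\<^sup>2) * ((q ^ (4 * s)) ^ m * q ^ m\<^sup>2)"
      by (simp only: power_add power_mult [symmetric])
    moreover have "int (m + 2 * s) - 2 * int s = int m" by simp
    moreover have "qpoch (a * q) q (m + 2 * s + 2 * s) = qpoch (a * q) q (4 * s) * qpoch (b * q) q m"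
      using qpoch_add[of "a * q" q "4 * s" m] by (simp add: bq add_ac)
    ultimately show "a ^ (2 * s) * q ^ (4 * s\<^sup>2) / qpoch (a * q) q (4 * s)
          * (b ^ m * q ^ m\<^sup>2 / (qpoch q q m * qpoch (b * q) q m)) = (f \<circ> (\<lambda>m. m + 2 * s)) m"
      unfolding f_def o_def by (simp add: b_def power_add power_mult_distrib mult_ac)
  qed
  finally have "(f has_sum a ^ (2 * s) * q ^ (4 * s\<^sup>2) / qpoch (a * q) q (4 * s)
      * (1 / qpoch_inf (b * q) q)) (range (\<lambda>m. m + 2 * s))"
    by (subst has_sum_reindex) (auto simp: inj_on_def o_def)
  also have "a ^ (2 * s) * q ^ (4 * s\<^sup>2) / qpoch (a * q) q (4 * s) * (1 / qpoch_inf (b * q) q)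
      = a ^ (2 * s) * q ^ (4 * s\<^sup>2) / qpoch_inf (a * q) q"
    using qpoch_inf_split[OF q, of "a * q" "4 * s"] by (simp add: bq)
  finally have sum_range:
    "(f has_sum a ^ (2 * s) * q ^ (4 * s\<^sup>2) / qpoch_inf (a * q) q) (range (\<lambda>m. m + 2 * s))" .
  have vanish: "f n = 0" if "n \<notin> range (\<lambda>m. m + 2 * s)" for n
  proof -
    have "n < 2 * s"
    proof (rule ccontr)
      assume "\<not> n < 2 * s"
      then have "n = (n - 2 * s) + 2 * s" by simp
      with that show False by blast
    qed
    then show ?thesis by (simp add: f_def)
  qed
  have "(f has_sum a ^ (2 * s) * q ^ (4 * s\<^sup>2) / qpoch_inf (a * q) q) UNIV
      \<longleftrightarrow> (f has_sum a ^ (2 * s) * q ^ (4 * s\<^sup>2) / qpoch_inf (a * q) q) (range (\<lambda>m. m + 2 * s))"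
    by (intro has_sum_cong_neutral) (auto simp: vanish)
  with sum_range show ?thesis unfolding f_def by blast
qed

section \<open>The identity\<close>

lemma unit_alpha_bounded:
  assumes "norm q < 1" and "a \<noteq> 1"
  obtains B where "\<And>r. norm (unit_alpha a q r) \<le> B" "0 \<le> B"
proof -
  obtain A where A: "\<And>n. norm (qpoch a q n) \<le> A" "0 \<le> A"
    using qpoch_bounded[OF assms(1)] by metis
  obtain C where C: "\<And>n. norm (1 / qpoch q q n) \<le> C" "0 \<le> C"
    using recip_qpoch_bounded[OF assms(1) qpoch_q_q_nonzero[OF assms(1)]] by metis
  have le1: "norm q ^ n \<le> 1" for n
    using assms by (intro power_le_one) auto
  have "norm (unit_alpha a q r) \<le> 1 * (1 + norm a) * A * C / norm (1 - a)" for r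
  proof -
    have "norm (1 - a * q ^ (2 * r)) \<le> norm (1::complex) + norm (a * q ^ (2 * r))"
      by (rule norm_triangle_ineq4)
    also have "\<dots> \<le> 1 + norm a"
      using le1[of "2 * r"] by (simp add: norm_mult norm_power mult_left_le)
    finally have n1: "norm (1 - a * q ^ (2 * r)) \<le> 1 + norm a" .
    have "norm (unit_alpha a q r) = norm q ^ (r choose 2) * norm (1 - a * q ^ (2 * r))
        * norm (qpoch a q r) * norm (1 / qpoch q q r) / norm (1 - a)"
      by (simp add: unit_alpha_def norm_mult norm_divide norm_power)
    also have "\<dots> \<le> 1 * (1 + norm a) * A * C / norm (1 - a)"
      by (intro divide_right_mono mult_mono n1 le1 A C mult_nonneg_nonneg norm_ge_zero) auto
    finally show ?thesis .
  qed
  then show ?thesis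
    using A C by (intro that[of "1 * (1 + norm a) * A * C / norm (1 - a)"]) auto
qed

theorem mainTheorem6:
  fixes a q :: complex
  assumes "norm q < 1"
    and "a \<noteq> 1"
    and "\<And>n. qpoch (a * q) (q\<^sup>2) n \<noteq> 0"
    and "qpoch_inf (a * q) q \<noteq> 0"
  shows "(\<lambda>(n, r). lhs_term a q n r) summable_on UNIV
       \<and> rhs_term a q summable_on UNIV
       \<and> (\<Sum>\<^sub>\<infinity>n. \<Sum>\<^sub>\<infinity>r. lhs_term a q n r) =
           1 / qpoch_inf (a * q) q * (\<Sum>\<^sub>\<infinity>r. rhs_term a q r)"
proof -
  note q = assms(1) and a = assms(2)
  have nz: "qpoch (a * q) q n \<noteq> 0" for n
    by (rule qpoch_nonzero_if_qpoch_inf_nonzero[OF q assms(4)])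
  have q2: "norm (q\<^sup>2) < 1"
    using q by (simp add: norm_power power_less_one_iff)
  have pow_less: "norm q ^ k < 1" if "0 < k" for k
    using q that by (simp add: power_less_one_iff)
  obtain B\<^sub>1 where B1: "\<And>n. norm (1 / qpoch (a * q) (q\<^sup>2) n) \<le> B\<^sub>1" "0 \<le> B\<^sub>1"
    using recip_qpoch_bounded[OF q2 assms(3)] by metis
  obtain B\<^sub>2 where B2: "\<And>n. norm (1 / qpoch (q\<^sup>2) (q\<^sup>2) n) \<le> B\<^sub>2" "0 \<le> B\<^sub>2"
    using recip_qpoch_bounded[OF q2 qpoch_q_q_nonzero[OF q2]] by metis
  obtain B\<^sub>3 where B3: "\<And>m. norm (recip_qpoch q m) \<le> B\<^sub>3" "0 \<le> B\<^sub>3"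
    using recip_qpoch_int_bounded[OF q] by metis
  obtain B\<^sub>4 where B4: "\<And>n. norm (1 / qpoch (a * q) q n) \<le> B\<^sub>4" "0 \<le> B\<^sub>4"
    using recip_qpoch_bounded[OF q nz] by metis
  obtain B\<^sub>5 where B5: "\<And>r. norm (unit_alpha a (q\<^sup>2) r) \<le> B\<^sub>5" "0 \<le> B\<^sub>5"
    using unit_alpha_bounded[OF q2 a] by metis

  have lhs_summable: "(\<lambda>(n, r). lhs_term a q n r) summable_on UNIV"
  proof (rule summable_on_prod_majorant)
    show "summable (\<lambda>n. B\<^sub>1 * B\<^sub>3 * (norm a ^ n * norm q ^ n\<^sup>2))"
      "summable (\<lambda>r. B\<^sub>2 * (norm a ^ r * (norm q ^ 2) ^ r\<^sup>2))"
      using pow_less[of 1] pow_less[of 2] by (auto intro!: summable_mult summable_power_mult_power_square)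
    fix n r
    have "norm (lhs_term a q n r) = norm a ^ n * norm q ^ n\<^sup>2 * (norm a ^ r * (norm q ^ 2) ^ r\<^sup>2)
        * (norm (1 / qpoch (a * q) (q\<^sup>2) n) * norm (recip_qpoch q (int n - 2 * int r))
           * norm (1 / qpoch (q\<^sup>2) (q\<^sup>2) r))"
      by (simp add: lhs_term_def norm_mult norm_divide norm_power power_add power_mult)
    also have "\<dots> \<le> norm a ^ n * norm q ^ n\<^sup>2 * (norm a ^ r * (norm q ^ 2) ^ r\<^sup>2) * (B\<^sub>1 * B\<^sub>3 * B\<^sub>2)"
      by (intro mult_mono B1 B2 B3 mult_nonneg_nonneg norm_ge_zero) auto
    finally show "norm (lhs_term a q n r)
        \<le> B\<^sub>1 * B\<^sub>3 * (norm a ^ n * norm q ^ n\<^sup>2) * (B\<^sub>2 * (norm a ^ r * (norm q ^ 2) ^ r\<^sup>2))"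
      by (simp add: mult_ac)
  qed (use B1 B2 B3 in auto)

  have rhs_summable: "rhs_term a q summable_on UNIV"
  proof (rule norm_summable_imp_summable_on, rule summable_comparison_test')
    show "summable (\<lambda>s. B\<^sub>5 * ((norm a ^ 4) ^ s * (norm q ^ 8) ^ s\<^sup>2))"
      using pow_less[of 8] by (intro summable_mult summable_power_mult_power_square) auto
    fix s
    have "norm (rhs_term a q s) = (norm a ^ 4) ^ s * (norm q ^ 8) ^ s\<^sup>2 * norm (unit_alpha a (q\<^sup>2) s)"
      by (simp add: rhs_term_eq norm_mult norm_power power_mult)
    also have "\<dots> \<le> (norm a ^ 4) ^ s * (norm q ^ 8) ^ s\<^sup>2 * B\<^sub>5"
      by (intro mult_left_mono B5) auto
    finally show "norm (norm (rhs_term a q s)) \<le> B\<^sub>5 * ((norm a ^ 4) ^ s * (norm q ^ 8) ^ s\<^sup>2)"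
      by (simp add: mult_ac)
  qed

  \<comment> \<open>\<open>\<alpha> s\<close> is the entry at the even index \<open>2 s\<close> of the final Bailey pair in base \<open>q\<close>.\<close>
  define \<alpha> where "\<alpha> = (\<lambda>s. a ^ (2 * s) * q ^ (4 * s\<^sup>2) * unit_alpha a (q\<^sup>2) s)"
  define T where "T = (\<lambda>n s. a ^ n * q ^ n\<^sup>2 * recip_qpoch q (int n - 2 * int s)
      / qpoch (a * q) q (n + 2 * s))"
  have T_0: "T n s = 0" "lhs_term a q n s = 0" if "n < s" for n s
    using that by (simp_all add: T_def lhs_term_def)
  have inner: "(\<Sum>\<^sub>\<infinity>r. lhs_term a q n r) = (\<Sum>\<^sub>\<infinity>s. \<alpha> s * T n s)" for n
  proof -
    have "(\<Sum>\<^sub>\<infinity>r. lhs_term a q n r) = (\<Sum>\<^sub>\<infinity>r\<in>{..n}. lhs_term a q n r)"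
      by (rule infsum_cong_neutral) (auto simp: T_0)
    also have "\<dots> = (\<Sum>s\<le>n. \<alpha> s * T n s)"
      using inner_sum_expansion[OF q a nz, of n] by (simp add: \<alpha>_def T_def)
    also have "\<dots> = (\<Sum>\<^sub>\<infinity>s\<in>{..n}. \<alpha> s * T n s)"
      by simp
    also have "\<dots> = (\<Sum>\<^sub>\<infinity>s. \<alpha> s * T n s)"
      by (rule infsum_cong_neutral) (auto simp: T_0)
    finally show ?thesis .
  qed
  have summ: "(\<lambda>(n, s). \<alpha> s * T n s) summable_on UNIV"
  proof (rule summable_on_prod_majorant)
    show "summable (\<lambda>n. B\<^sub>3 * B\<^sub>4 * (norm a ^ n * norm q ^ n\<^sup>2))"
      "summable (\<lambda>s. B\<^sub>5 * ((norm a ^ 2) ^ s * (norm q ^ 4) ^ s\<^sup>2))"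
      using pow_less[of 1] pow_less[of 4] by (auto intro!: summable_mult summable_power_mult_power_square)
    fix n s
    have "norm (\<alpha> s * T n s) = norm a ^ n * norm q ^ n\<^sup>2 * ((norm a ^ 2) ^ s * (norm q ^ 4) ^ s\<^sup>2)
        * (norm (recip_qpoch q (int n - 2 * int s)) * norm (1 / qpoch (a * q) q (n + 2 * s))
           * norm (unit_alpha a (q\<^sup>2) s))"
      by (simp add: \<alpha>_def T_def norm_mult norm_divide norm_power power_mult)
    also have "\<dots> \<le> norm a ^ n * norm q ^ n\<^sup>2 * ((norm a ^ 2) ^ s * (norm q ^ 4) ^ s\<^sup>2) * (B\<^sub>3 * B\<^sub>4 * B\<^sub>5)"
      by (intro mult_mono B3 B4 B5 mult_nonneg_nonneg norm_ge_zero) auto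
    finally show "norm (\<alpha> s * T n s)
        \<le> B\<^sub>3 * B\<^sub>4 * (norm a ^ n * norm q ^ n\<^sup>2) * (B\<^sub>5 * ((norm a ^ 2) ^ s * (norm q ^ 4) ^ s\<^sup>2))"
      by (simp add: mult_ac)
  qed (use B3 B4 B5 in auto)
  have "(\<Sum>\<^sub>\<infinity>n. \<Sum>\<^sub>\<infinity>r. lhs_term a q n r) = (\<Sum>\<^sub>\<infinity>s. \<Sum>\<^sub>\<infinity>n. \<alpha> s * T n s)"
    unfolding inner using summ by (intro infsum_swap_banach) simp
  also have "\<dots> = (\<Sum>\<^sub>\<infinity>s. \<alpha> s * (a ^ (2 * s) * q ^ (4 * s\<^sup>2) / qpoch_inf (a * q) q))"
    unfolding infsum_cmult_right' T_def infsumI[OF shifted_cauchy_identity[OF q nz]] ..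
  also have "\<dots> = (\<Sum>\<^sub>\<infinity>s. 1 / qpoch_inf (a * q) q * rhs_term a q s)"
  proof (rule infsum_cong)
    fix s
    have "a ^ (4 * s) = a ^ (2 * s) * a ^ (2 * s)" "q ^ (8 * s\<^sup>2) = q ^ (4 * s\<^sup>2) * q ^ (4 * s\<^sup>2)"
      by (simp_all add: power_add [symmetric])
    then show "\<alpha> s * (a ^ (2 * s) * q ^ (4 * s\<^sup>2) / qpoch_inf (a * q) q)
        = 1 / qpoch_inf (a * q) q * rhs_term a q s"
      by (simp add: \<alpha>_def rhs_term_eq mult_ac)
  qed
  also have "\<dots> = 1 / qpoch_inf (a * q) q * (\<Sum>\<^sub>\<infinity>r. rhs_term a q r)"
    by (rule infsum_cmult_right')
  finally show ?thesis
    using lhs_summable rhs_summable by simp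
qed

end
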